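(* Let $g(z)=\sum_{n=0}^{\infty} b_n z^n$ be analytic in the unit disc $\mathbb{D}$ and let $\beta\in\mathbb{R}$. Then the following conditions are equivalent: (1) The operator $\mathcal{H}_g:\mathcal{D}\to\mathcal{D}^2_\beta$ is bounded. (2) $\displaystyle\sum_{n=N}^\infty n^{1-\beta}|b_n|^2=O\left(\frac{1}{\log N}\right)$ as $N\to\infty$.
   Context: $\mathbb{D}$ is the open unit disc of $\mathbb{C}$ and $H(\mathbb{D})$ is the space of all analytic functions in $\mathbb{D}$. For $g\in H(\mathbb{D})$ the generalized Hilbert operator is $\mathcal{H}_g(f)(z)=\int_0^1 f(t)g'(tz)\,dt$, $z\in\mathbb{D}$, for $f\in H(\mathbb{D})$ with $\int_0^1|f(t)|\,dt<\infty$ (this holds for every $f\in\mathcal{D}$). For $\gamma\in\mathbb{R}$, $\mathcal{D}^2_\gamma$ is the space of $h(z)=\sum_{n\ge0}c_nz^n\in H(\mathbb{D})$ with $\|h\|^2_{\mathcal{D}^2_\gamma}=|c_0|^2+\sum_{n=1}^\infty n^{1-\gamma}|c_n|^2<\infty$. $\mathcal{D}=\mathcal{D}^2_0$ is the classical Dirichlet space. *)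

theory Defs
  imports "HOL-Complex_Analysis.Complex_Analysis" "HOL-Library.Landau_Symbols"
begin

text \<open>
  Functions on the unit disc are total functions on the complex plane of which only the values on
  \<open>ball 0 1\<close> matter: every notion below depends on its function arguments only through their
  restriction to the disc.
\<close>

definition taylor_coeff :: "(complex \<Rightarrow> complex) \<Rightarrow> nat \<Rightarrow> complex" where
  "taylor_coeff h n = fps_nth (fps_expansion h 0) n"

definition dirichlet_space :: "real \<Rightarrow> (complex \<Rightarrow> complex) set" where
  "dirichlet_space \<gamma> =
     {h. h holomorphic_on ball 0 1 \<and>
         summable (\<lambda>n. real (Suc n) powr (1 - \<gamma>) * (cmod (taylor_coeff h (Suc n)))\<^sup>2)}"

definition dirichlet_norm :: "real \<Rightarrow> (complex \<Rightarrow> complex) \<Rightarrow> real" where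
  "dirichlet_norm \<gamma> h =
     sqrt ((cmod (taylor_coeff h 0))\<^sup>2 +
           (\<Sum>n. real (Suc n) powr (1 - \<gamma>) * (cmod (taylor_coeff h (Suc n)))\<^sup>2))"

definition hilbert_op :: "(complex \<Rightarrow> complex) \<Rightarrow> (complex \<Rightarrow> complex) \<Rightarrow> complex \<Rightarrow> complex" where
  "hilbert_op g f z =
     (LBINT t:{0..<1}. f (complex_of_real t) * deriv g (complex_of_real t * z))"

text \<open>
  Boundedness of an operator between two of these spaces. Linearity is not part of the definition:
  \<open>hilbert_op g\<close> is linear on the functions that are integrable on \<open>[0, 1)\<close>.
\<close>

definition bounded_dirichlet_op ::
    "real \<Rightarrow> real \<Rightarrow> ((complex \<Rightarrow> complex) \<Rightarrow> complex \<Rightarrow> complex) \<Rightarrow> bool" where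
  "bounded_dirichlet_op \<alpha> \<beta> T \<longleftrightarrow>
     (\<forall>f\<in>dirichlet_space \<alpha>. T f \<in> dirichlet_space \<beta>) \<and>
     (\<exists>C. \<forall>f\<in>dirichlet_space \<alpha>. dirichlet_norm \<beta> (T f) \<le> C * dirichlet_norm \<alpha> f)"

end

theory Submission
  imports Defs
begin

text \<open>
  If \<open>f(z) = \<Sum> a\<^sub>k z\<^sup>k\<close> then the \<open>n\<close>-th Taylor coefficient of \<open>hilbert_op g f\<close> is
  \<open>(n+1) b\<^sub>n\<^sub>+\<^sub>1 \<mu>\<^sub>n\<close> with the moment \<open>\<mu>\<^sub>n = \<integral>\<^sub>0\<^sup>1 t\<^sup>n f(t) dt = \<Sum>\<^sub>k a\<^sub>k / (n+k+1)\<close>.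
  Testing boundedness on \<open>\<Sum>\<^sub>k\<^sub><\<^sub>N z\<^sup>k / (k+1)\<close>, whose squared norm is at most \<open>H\<^sub>N\<close> and for which
  \<open>(n+1) \<mu>\<^sub>n \<ge> H\<^sub>N / 2\<close> when \<open>n+1 \<ge> N\<close>, gives the tail condition.
  Conversely, \<open>(n+1) |\<mu>\<^sub>n|\<close> is at most \<open>\<Sum>\<^sub>k\<^sub>\<le>\<^sub>n |a\<^sub>k|\<close> plus a multiple of the norm of \<open>f\<close>, and
  the tail condition is exactly Muckenhoupt's condition for the weighted Hardy inequality that
  controls the partial sums \<open>\<Sum>\<^sub>k\<^sub>\<le>\<^sub>n |a\<^sub>k|\<close>.
\<close>

subsection \<open>Taylor coefficients and moments\<close>

lemma taylor_coeff_sums: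
  assumes "h holomorphic_on ball 0 1" "z \<in> ball 0 1"
  shows "(\<lambda>n. taylor_coeff h n * z ^ n) sums h z"
  using assms holomorphic_iff_power_series[of h 0 1]
  by (simp add: taylor_coeff_def fps_expansion_def)

lemma taylor_coeff_eqI:
  assumes "\<And>z. z \<in> ball 0 1 \<Longrightarrow> (\<lambda>n. c n * z ^ n) sums h z"
  shows "taylor_coeff h = c"
proof -
  have "h has_fps_expansion Abs_fps c"
    unfolding has_fps_expansion_def
  proof
    \<comment> \<open>Any nonzero point of the disc would do: convergence there forces a positive
      radius of convergence, after which uniqueness of power series expansions identifies the
      coefficients.\<close>
    have "summable (\<lambda>n. c n * (1/2) ^ n)"
      using assms[of "1/2"] by (auto simp: sums_iff)
    then have "ereal (norm (1/2 :: complex)) \<le> conv_radius c"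
      by (rule conv_radius_geI)
    then show "fps_conv_radius (Abs_fps c) > 0"
      by (auto simp: fps_conv_radius_def intro: less_le_trans[of _ "ereal (1/2)"])
    show "\<forall>\<^sub>F z in nhds 0. eval_fps (Abs_fps c) z = h z"
      by (rule eventually_nhds_in_open[of "ball 0 1", THEN eventually_mono])
         (use assms in \<open>auto simp: eval_fps_def sums_iff\<close>)
  qed
  then show ?thesis
    by (auto simp: taylor_coeff_def fps_expansion_eqI fun_eq_iff)
qed

lemma taylor_coeff_deriv:
  "taylor_coeff (deriv h) n = of_nat (Suc n) * taylor_coeff h (Suc n)"
  by (simp add: taylor_coeff_def fps_expansion_def funpow_Suc_right field_simps del: funpow.simps of_nat_Suc)

lemma summable_norm_power_series_ball:
  fixes c :: "nat \<Rightarrow> complex"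
  assumes "\<And>z. z \<in> ball 0 1 \<Longrightarrow> summable (\<lambda>n. c n * z ^ n)" and "cmod z < 1"
  shows "summable (\<lambda>n. norm (c n * z ^ n))"
proof -
  obtain r where r: "cmod z < r" "r < 1"
    using assms(2) dense by blast
  then have "0 \<le> r"
    using norm_ge_zero[of z] by linarith
  then show ?thesis
    using powser_insidea[of c "complex_of_real r" z] assms(1)[of "complex_of_real r"] r by simp
qed

section \<open>Termwise integration and the coefficients of the Hilbert operator\<close>

text \<open>Sum and integral may be exchanged because the integrals of the norms are summable. This
  serves twice with the roles swapped: \<open>G\<close> is a power of \<open>t\<close> and
  \<open>S\<close> is \<open>f\<close> for the moments, then \<open>G\<close> is \<open>f\<close>
  and \<open>S\<close> is the derivative of \<open>g\<close> along the segment from 0 to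
  \<open>z\<close>.\<close>

lemma set_integral_times_power_series:
  fixes G :: "real \<Rightarrow> complex" and c :: "nat \<Rightarrow> complex"
  assumes G: "set_integrable lborel {0..<1} G"
    and abs: "\<And>t. 0 \<le> t \<Longrightarrow> t < 1 \<Longrightarrow> summable (\<lambda>k. norm (c k * complex_of_real t ^ k))"
    and S: "\<And>t. 0 \<le> t \<Longrightarrow> t < 1 \<Longrightarrow> (\<lambda>k. c k * complex_of_real t ^ k) sums S t"
    and sm: "summable (\<lambda>k. cmod (c k) * (LBINT t:{0..<1}. cmod (G t) * t ^ k))"
  shows "set_integrable lborel {0..<1} (\<lambda>t. G t * S t)"
    and "(\<lambda>k. c k * (LBINT t:{0..<1}. G t * complex_of_real t ^ k)) sums (LBINT t:{0..<1}. G t * S t)"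
proof -
  have Gk: "set_integrable lborel {0..<1} (\<lambda>t. G t * complex_of_real t ^ k)" for k
    unfolding set_integrable_def
  proof (rule Bochner_Integration.integrable_bound)
    show "integrable lborel (\<lambda>t. indicator {0..<1} t *\<^sub>R G t)"
      using G by (simp add: set_integrable_def)
    then have "(\<lambda>t. (indicator {0..<1} t *\<^sub>R G t) * complex_of_real t ^ k) \<in> borel_measurable lborel"
      by measurable
    then show "(\<lambda>t. indicator {0..<1} t *\<^sub>R (G t * complex_of_real t ^ k)) \<in> borel_measurable lborel"
      by simp
    show "AE t in lborel. norm (indicator {0..<1} t *\<^sub>R (G t * complex_of_real t ^ k))
        \<le> norm (indicator {0..<1} t *\<^sub>R G t)"
      by (auto simp: indicator_def norm_mult norm_power intro!: AE_I2 mult_left_le power_le_one)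
  qed
  define F where "F k t = indicator {0..<1} t *\<^sub>R (c k * (G t * complex_of_real t ^ k))" for k t
  have F1: "integrable lborel (F k)" for k
    using Gk[of k] unfolding F_def set_integrable_def
    by (subst mult_scaleR_right[symmetric]) (rule integrable_mult_right)
  have nF: "norm (F k t) = cmod (c k) * (indicator {0..<1} t *\<^sub>R (cmod (G t) * t ^ k))" for k t
    by (auto simp: F_def indicator_def norm_mult norm_power)
  have F2: "summable (\<lambda>k. \<integral>t. norm (F k t) \<partial>lborel)"
    using sm by (simp add: nF set_lebesgue_integral_def)
  have F3: "AE t in lborel. summable (\<lambda>k. norm (F k t))"
  proof (intro AE_I2)
    fix t :: real
    show "summable (\<lambda>k. norm (F k t))"
    proof (cases "t \<in> {0..<1}")
      case True
      then have "summable (\<lambda>k. norm (c k * complex_of_real t ^ k) * cmod (G t))"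
        by (intro summable_mult2 abs) auto
      moreover have "norm (F k t) = norm (c k * complex_of_real t ^ k) * cmod (G t)" for k
        using True by (simp add: F_def norm_mult)
      ultimately show ?thesis by (simp only:)
    qed (simp add: F_def)
  qed
  have sumF: "(\<Sum>k. F k t) = indicator {0..<1} t *\<^sub>R (G t * S t)" for t
  proof (cases "t \<in> {0..<1}")
    case True
    then have "(\<lambda>k. G t * (c k * complex_of_real t ^ k)) sums (G t * S t)"
      by (intro sums_mult S) auto
    then show ?thesis using True
      by (simp add: F_def sums_iff mult_ac)
  qed (simp add: F_def)
  show "set_integrable lborel {0..<1} (\<lambda>t. G t * S t)"
    using integrable_suminf[OF F1 F3 F2] by (simp add: sumF set_integrable_def)
  have "integral\<^sup>L lborel (F k) = c k * (LBINT t:{0..<1}. G t * complex_of_real t ^ k)" for k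
    unfolding F_def set_lebesgue_integral_def
    by (subst mult_scaleR_right[symmetric]) (rule integral_mult_right_zero)
  then show "(\<lambda>k. c k * (LBINT t:{0..<1}. G t * complex_of_real t ^ k)) sums (LBINT t:{0..<1}. G t * S t)"
    using sums_integral[OF F1 F3 F2] by (simp add: sumF set_lebesgue_integral_def)
qed

lemma set_integral_power_01:
  "set_integrable lborel {0..<1} (\<lambda>t::real. t ^ n)"
  "(LBINT t:{0..<1}. t ^ n :: real) = 1 / real (Suc n)"
proof -
  \<comment> \<open>The endpoint 1 is a null set, so the closed-interval results transfer.\<close>
  have eq: "AE t in lborel. indicator {0..<1} t *\<^sub>R t ^ n = t ^ n * (indicator {0..1} t :: real)"
    using AE_lborel_singleton[of "1::real"]
    by eventually_elim (auto simp: indicator_def)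
  have "integrable lborel (\<lambda>t::real. t ^ n * indicator {0..1} t)"
    by (intro borel_integrable_atLeastAtMost) auto
  then show "set_integrable lborel {0..<1} (\<lambda>t::real. t ^ n)"
    unfolding set_integrable_def by (subst integrable_cong_AE[OF _ _ eq]) auto
  show "(LBINT t:{0..<1}. t ^ n :: real) = 1 / real (Suc n)"
    unfolding set_lebesgue_integral_def
    using integral_power[of 0 1 n] by (subst integral_cong_AE[OF _ _ eq]) auto
qed

lemma moments_power_series_01:
  assumes f: "f holomorphic_on ball 0 1"
    and sm: "summable (\<lambda>k. cmod (taylor_coeff f k) / real (Suc k))"
  shows "set_integrable lborel {0..<1} (\<lambda>t. f (complex_of_real t))"
    and "(\<lambda>k. taylor_coeff f k / of_nat (n + k + 1)) sums
           (LBINT t:{0..<1}. f (complex_of_real t) * complex_of_real t ^ n)"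
proof -
  let ?a = "taylor_coeff f"
  have ser: "(\<lambda>k. ?a k * complex_of_real t ^ k) sums f (complex_of_real t)" if "0 \<le> t" "t < 1" for t
    using that by (intro taylor_coeff_sums f) auto
  have abs: "summable (\<lambda>k. norm (?a k * complex_of_real t ^ k))" if "0 \<le> t" "t < 1" for t
    by (rule summable_norm_power_series_ball)
       (use that taylor_coeff_sums[OF f] in \<open>auto simp: sums_iff\<close>)
  have int: "set_integrable lborel {0..<1} (\<lambda>t. complex_of_real t ^ m)"
    "(LBINT t:{0..<1}. complex_of_real t ^ m) = 1 / of_nat (Suc m)" for m
  proof -
    have eq: "(\<lambda>t. complex_of_real t ^ m) = (\<lambda>t. complex_of_real (t ^ m))"
      by (simp add: fun_eq_iff)
    show "set_integrable lborel {0..<1} (\<lambda>t. complex_of_real t ^ m)"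
      using set_integral_power_01(1)[of m] unfolding eq set_integrable_def
      by (simp add: scaleR_conv_of_real flip: of_real_mult of_real_power)
    show "(LBINT t:{0..<1}. complex_of_real t ^ m) = 1 / of_nat (Suc m)"
      unfolding eq set_integral_complex_of_real set_integral_power_01 by simp
  qed
  \<comment> \<open>Since \<open>1/(m+k+1)\<close> is at most \<open>1/(k+1)\<close>, the single
    hypothesis \<open>sm\<close> dominates the series of every moment.\<close>
  have sm': "summable (\<lambda>k. cmod (?a k) * (LBINT t:{0..<1}. cmod (complex_of_real t ^ m) * t ^ k))" for m
  proof (rule summable_comparison_test'[OF sm, of 0])
    fix k
    have "(LBINT t:{0..<1}. cmod (complex_of_real t ^ m) * t ^ k) = (LBINT t:{0..<1}. t ^ (m + k))"
      by (rule set_lebesgue_integral_cong) (auto simp: norm_power power_add)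
    also have "\<dots> = 1 / real (Suc (m + k))" by (rule set_integral_power_01)
    finally show "norm (cmod (?a k) * (LBINT t:{0..<1}. cmod (complex_of_real t ^ m) * t ^ k))
        \<le> cmod (?a k) / real (Suc k)"
      by (auto simp: intro!: divide_left_mono)
  qed
  show "set_integrable lborel {0..<1} (\<lambda>t. f (complex_of_real t))"
    using set_integral_times_power_series(1)[OF int(1)[of 0] abs ser sm'[of 0]] by simp
  show "(\<lambda>k. ?a k / of_nat (n + k + 1)) sums
           (LBINT t:{0..<1}. f (complex_of_real t) * complex_of_real t ^ n)"
    using set_integral_times_power_series(2)[OF int(1)[of n] abs ser sm'[of n]]
    by (simp add: int mult.commute add_ac flip: power_add)
qed

text \<open>Expand the derivative of \<open>g\<close> at \<open>t * z\<close> in powers of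
  \<open>z\<close> and integrate term by term; integrability of \<open>f\<close> suffices for
  this.\<close>

lemma hilbert_op_taylor:
  fixes f g :: "complex \<Rightarrow> complex"
  assumes g: "g holomorphic_on ball 0 1"
    and f: "set_integrable lborel {0..<1} (\<lambda>t. f (complex_of_real t))"
  defines "d \<equiv> \<lambda>n. of_nat (Suc n) * taylor_coeff g (Suc n) *
      (LBINT t:{0..<1}. f (complex_of_real t) * complex_of_real t ^ n)"
  shows "hilbert_op g f holomorphic_on ball 0 1" "taylor_coeff (hilbert_op g f) = d"
proof -
  let ?e = "\<lambda>n. of_nat (Suc n) * taylor_coeff g (Suc n)"
  have "deriv g holomorphic_on ball 0 1"
    using g by (intro holomorphic_deriv) auto
  from taylor_coeff_sums[OF this]
  have ser: "(\<lambda>n. ?e n * z ^ n) sums deriv g z" if "z \<in> ball 0 1" for z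
    using that by (simp add: taylor_coeff_deriv)
  have abs: "summable (\<lambda>n. norm (?e n * z ^ n))" if "cmod z < 1" for z
    by (rule summable_norm_power_series_ball) (use that ser in \<open>auto simp: sums_iff\<close>)
  have main: "(\<lambda>n. d n * z ^ n) sums hilbert_op g f z" if z: "z \<in> ball 0 1" for z
  proof -
    have tz: "cmod (complex_of_real t * z) < 1" if "0 \<le> t" "t < 1" for t
      using that z mult_left_le_one_le[of "cmod z" t] by (simp add: norm_mult)
    have 1: "summable (\<lambda>k. norm (?e k * z ^ k * complex_of_real t ^ k))" if "0 \<le> t" "t < 1" for t
      using abs[OF tz[OF that]] by (simp add: power_mult_distrib mult_ac)
    have 2: "(\<lambda>k. ?e k * z ^ k * complex_of_real t ^ k) sums deriv g (complex_of_real t * z)"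
      if "0 \<le> t" "t < 1" for t
      using ser[of "complex_of_real t * z"] tz[OF that] by (simp add: power_mult_distrib mult_ac)
    \<comment> \<open>The moments of \<open>|f|\<close> are at most its integral, so only absolute
      convergence of the series of \<open>deriv g\<close> at \<open>z\<close> is needed.\<close>
    have 3: "summable (\<lambda>k. cmod (?e k * z ^ k) * (LBINT t:{0..<1}. cmod (f (complex_of_real t)) * t ^ k))"
    proof (rule summable_comparison_test'[of _ 0])
      show "summable (\<lambda>k. cmod (?e k * z ^ k) * (LBINT t:{0..<1}. cmod (f (complex_of_real t))))"
        using z by (intro summable_mult2 abs) auto
      fix k
      have fi: "set_integrable lborel {0..<1} (\<lambda>t. cmod (f (complex_of_real t)))"
        using f by (rule set_integrable_norm)
      have nn: "0 \<le> (LBINT t:{0..<1}. cmod (f (complex_of_real t)) * t ^ k)"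
        by (auto simp: set_lebesgue_integral_def indicator_def intro!: integral_nonneg_AE)
      have "(LBINT t:{0..<1}. cmod (f (complex_of_real t)) * t ^ k)
          \<le> (LBINT t:{0..<1}. cmod (f (complex_of_real t)))"
        unfolding set_lebesgue_integral_def
        by (rule integral_mono_AE')
           (use fi in \<open>auto simp: set_integrable_def indicator_def intro!: mult_left_le power_le_one\<close>)
      with nn show "norm (cmod (?e k * z ^ k) * (LBINT t:{0..<1}. cmod (f (complex_of_real t)) * t ^ k))
          \<le> cmod (?e k * z ^ k) * (LBINT t:{0..<1}. cmod (f (complex_of_real t)))"
        unfolding real_norm_def abs_mult by (intro mult_mono) auto
    qed
    show ?thesis
      using set_integral_times_power_series(2)[OF f 1 2 3]
      by (simp add: hilbert_op_def d_def mult_ac)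
  qed
  show "hilbert_op g f holomorphic_on ball 0 1"
    by (rule power_series_holomorphic[of 0 1 d]) (use main in simp)
  show "taylor_coeff (hilbert_op g f) = d"
    by (rule taylor_coeff_eqI[OF main])
qed

subsection \<open>A weighted Hardy inequality\<close>

text \<open>The right side is the integral of \<open>1/sqrt s\<close> from \<open>y\<close> to
  \<open>x\<close>, and the integrand is smallest at \<open>x\<close>. This makes both sums in the
  Hardy inequality telescope, once along harmonic numbers and once along tails.\<close>

lemma diff_over_sqrt_le:
  fixes x y :: real
  assumes "0 \<le> y" "y \<le> x"
  shows "(x - y) / sqrt x \<le> 2 * (sqrt x - sqrt y)"
proof (cases "x = 0")
  case True
  then show ?thesis using assms by simp
next
  case False
  then have x: "sqrt x > 0" using assms by simp
  have s: "0 \<le> sqrt y" "sqrt y \<le> sqrt x" using assms by auto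
  have "x - y = (sqrt x - sqrt y) * (sqrt x + sqrt y)"
    using assms by (simp add: algebra_simps)
  also have "\<dots> \<le> (sqrt x - sqrt y) * (2 * sqrt x)"
    using s by (intro mult_left_mono) auto
  finally show ?thesis using x by (simp add: field_simps)
qed

lemma sum_harm_inverse_sqrt_le:
  "(\<Sum>k\<le>n. 1 / (real (Suc k) * sqrt (harm (Suc k)))) \<le> 2 * sqrt (harm (Suc n))"
proof -
  have "(\<Sum>k\<le>n. 1 / (real (Suc k) * sqrt (harm (Suc k))))
      \<le> (\<Sum>k<Suc n. 2 * sqrt (harm (Suc k)) - 2 * sqrt (harm k))"
    unfolding lessThan_Suc_atMost
  proof (rule sum_mono)
    fix k
    show "1 / (real (Suc k) * sqrt (harm (Suc k))) \<le> 2 * sqrt (harm (Suc k)) - 2 * sqrt (harm k)"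
      using diff_over_sqrt_le[of "harm k" "harm (Suc k)"] harm_nonneg[of k, where ?'a=real]
      by (simp add: harm_Suc field_simps)
  qed
  also have "\<dots> = 2 * sqrt (harm (Suc n))"
    by (subst sum_lessThan_telescope) (simp add: harm_def)
  finally show ?thesis .
qed

text \<open>
  Cauchy-Schwarz with the weights \<open>(k+1) (harm (k+1))\<^sup>1\<^sup>/\<^sup>2\<close>; after exchanging the sums, the
  hypothesis replaces \<open>(harm (n+1))\<^sup>1\<^sup>/\<^sup>2\<close> by a power of the tail of \<open>u\<close>, and the inner sum telescopes.
\<close>

lemma hardy_harm_weight:
  fixes u c :: "nat \<Rightarrow> real"
  assumes u: "\<And>n. 0 \<le> u n" and su: "summable u"
    and B: "\<And>n. (\<Sum>i. u (i + n)) * harm (Suc n) \<le> B"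
  shows "(\<Sum>n<N. u n * (\<Sum>k\<le>n. c k)\<^sup>2) \<le> 4 * B * (\<Sum>k<N. real (Suc k) * (c k)\<^sup>2)"
proof -
  define U where "U n = (\<Sum>i. u (i + n))" for n
  define L where "L n = (harm (Suc n) :: real)" for n
  have L: "L n > 0" for n by (simp add: L_def)
  have Unn: "0 \<le> U n" for n
    unfolding U_def by (intro suminf_nonneg summable_ignore_initial_segment su) (simp add: u)
  have USuc: "U n - U (Suc n) = u n" for n
    using suminf_split_head[OF summable_ignore_initial_segment[OF su], of n] by (simp add: U_def)
  have UL: "U n * L n \<le> B" for n using B by (simp add: U_def L_def)
  have Bnn: "0 \<le> B" using UL[of 0] Unn[of 0] L[of 0] by (meson mult_nonneg_nonneg less_imp_le order_trans)
  have sqrtUL: "sqrt (U n) * sqrt (L n) \<le> sqrt B" for n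
    using UL[of n] by (simp flip: real_sqrt_mult)
  have cs: "(\<Sum>k\<le>n. c k)\<^sup>2 \<le> (\<Sum>k\<le>n. real (Suc k) * (c k)\<^sup>2 * sqrt (L k)) * (2 * sqrt (L n))" for n
  proof -
    \<comment> \<open>The square of \<open>?x k\<close> is the Cauchy-Schwarz weight; its
      reciprocals are summed by \<open>sum_harm_inverse_sqrt_le\<close>.\<close>
    let ?x = "\<lambda>k. sqrt (real (Suc k) * sqrt (L k))"
    have x: "?x k > 0" for k using L by simp
    have "(\<Sum>k\<le>n. c k)\<^sup>2 = (\<Sum>k\<le>n. (c k * ?x k) * (1 / ?x k))\<^sup>2"
      using less_imp_neq[OF x, symmetric] by simp
    also have "\<dots> \<le> (\<Sum>k\<le>n. (c k * ?x k)\<^sup>2) * (\<Sum>k\<le>n. (1 / ?x k)\<^sup>2)"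
      by (rule Cauchy_Schwarz_ineq_sum)
    also have "(\<Sum>k\<le>n. (c k * ?x k)\<^sup>2) = (\<Sum>k\<le>n. real (Suc k) * (c k)\<^sup>2 * sqrt (L k))"
      using L by (intro sum.cong) (auto simp: power_mult_distrib less_imp_le)
    also have "(\<Sum>k\<le>n. (1 / ?x k)\<^sup>2) = (\<Sum>k\<le>n. 1 / (real (Suc k) * sqrt (harm (Suc k))))"
      using L by (intro sum.cong) (auto simp: power_divide less_imp_le L_def)
    also have "\<dots> \<le> 2 * sqrt (L n)"
      unfolding L_def by (rule sum_harm_inverse_sqrt_le)
    finally show ?thesis
      using L by (simp add: mult_left_mono sum_nonneg less_imp_le)
  qed
  \<comment> \<open>Here \<open>sqrt (L n)\<close> is at most \<open>sqrt B / sqrt (U n)\<close>,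
    and \<open>u n\<close> is the decrement \<open>U n - U (Suc n)\<close>, so
    \<open>diff_over_sqrt_le\<close> applies.\<close>
  have tail: "(\<Sum>n\<in>{k..<N}. u n * sqrt (L n)) \<le> 2 * sqrt B * sqrt (U k)" if "k \<le> N" for k
  proof -
    have "(\<Sum>n\<in>{k..<N}. u n * sqrt (L n)) \<le> (\<Sum>n\<in>{k..<N}. sqrt B * (2 * sqrt (U n) - 2 * sqrt (U (Suc n))))"
    proof (rule sum_mono)
      fix n
      show "u n * sqrt (L n) \<le> sqrt B * (2 * sqrt (U n) - 2 * sqrt (U (Suc n)))"
      \<comment> \<open>The argument divides by \<open>sqrt (U n)\<close>; if the tail vanishes, so
        does \<open>u n\<close>.\<close>
      proof (cases "U n = 0")
        case True
        then have "U (Suc n) = 0" "u n = 0"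
          using USuc[of n] u[of n] Unn[of "Suc n"] by linarith+
        with True show ?thesis by simp
      next
        case False
        then have U: "sqrt (U n) > 0" using Unn[of n] by simp
        have "u n * sqrt (L n) = u n / sqrt (U n) * (sqrt (U n) * sqrt (L n))"
          using U by simp
        also have "\<dots> \<le> u n / sqrt (U n) * sqrt B"
          using U u by (intro mult_left_mono sqrtUL) auto
        also have "\<dots> \<le> (2 * (sqrt (U n) - sqrt (U (Suc n)))) * sqrt B"
          using diff_over_sqrt_le[of "U (Suc n)" "U n"] USuc[of n] u[of n] Unn Bnn
          by (intro mult_right_mono) auto
        finally show ?thesis by (simp add: algebra_simps)
      qed
    qed
    also have "\<dots> = sqrt B * (2 * sqrt (U k) - 2 * sqrt (U N))"
      unfolding sum_distrib_left[symmetric]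
      using sum_Suc_diff'[OF that, of "\<lambda>n. - 2 * sqrt (U n)"] by simp
    also have "\<dots> \<le> 2 * sqrt B * sqrt (U k)"
      using Bnn Unn by (simp add: algebra_simps)
    finally show ?thesis .
  qed
  have "(\<Sum>n<N. u n * (\<Sum>k\<le>n. c k)\<^sup>2)
      \<le> (\<Sum>n<N. u n * ((\<Sum>k\<le>n. real (Suc k) * (c k)\<^sup>2 * sqrt (L k)) * (2 * sqrt (L n))))"
    by (intro sum_mono mult_left_mono cs u)
  also have "\<dots> = (\<Sum>n<N. \<Sum>k\<le>n. 2 * (real (Suc k) * (c k)\<^sup>2 * sqrt (L k)) * (u n * sqrt (L n)))"
    by (intro sum.cong) (auto simp: sum_distrib_left sum_distrib_right mult_ac)
  \<comment> \<open>Exchange of the order of summation over the triangle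
    \<open>k <= n < N\<close>.\<close>
  also have "\<dots> = (\<Sum>k<N. \<Sum>n\<in>{k..<N}. 2 * (real (Suc k) * (c k)\<^sup>2 * sqrt (L k)) * (u n * sqrt (L n)))"
    unfolding sum.Sigma[OF finite_lessThan ballI[OF finite_atMost]]
      sum.Sigma[OF finite_lessThan ballI[OF finite_atLeastLessThan]]
    by (rule sum.reindex_bij_witness[where i="\<lambda>(x,y). (y,x)" and j="\<lambda>(x,y). (y,x)"]) auto
  also have "\<dots> \<le> (\<Sum>k<N. 2 * (real (Suc k) * (c k)\<^sup>2 * sqrt (L k)) * (2 * sqrt B * sqrt (U k)))"
    unfolding sum_distrib_left[symmetric]
    using L by (intro sum_mono mult_left_mono tail) (auto simp: less_imp_le)
  \<comment> \<open>The factors 2 from \<open>cs\<close> and 2 from \<open>tail\<close> give the 4;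
    a second use of \<open>sqrtUL\<close> turns \<open>sqrt B\<close> into \<open>B\<close>.\<close>
  also have "\<dots> \<le> (\<Sum>k<N. 4 * B * (real (Suc k) * (c k)\<^sup>2))"
  proof (rule sum_mono)
    fix k
    have "2 * (real (Suc k) * (c k)\<^sup>2 * sqrt (L k)) * (2 * sqrt B * sqrt (U k))
        = 4 * (real (Suc k) * (c k)\<^sup>2) * (sqrt B * (sqrt (U k) * sqrt (L k)))"
      by simp
    also have "\<dots> \<le> 4 * (real (Suc k) * (c k)\<^sup>2) * (sqrt B * sqrt B)"
      using Bnn by (intro mult_left_mono sqrtUL) auto
    finally show "2 * (real (Suc k) * (c k)\<^sup>2 * sqrt (L k)) * (2 * sqrt B * sqrt (U k))
        \<le> 4 * B * (real (Suc k) * (c k)\<^sup>2)"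
      using Bnn by (simp add: mult_ac)
  qed
  finally show ?thesis by (simp add: sum_distrib_left)
qed

section \<open>Estimates for the kernel \<open>(n+1)/(n+k+1)\<close>\<close>

text \<open>Bounding one factor \<open>(n+1)/(k+1)\<close> by 1 leaves a sum dominated by the
  telescoping \<open>1/((n+k)(n+k+1))\<close>, whose total is at most
  \<open>1/(2n+1)\<close>.\<close>

lemma sum_inverse_cube_tail_le:
  "(\<Sum>k\<in>{Suc n..<m}. (real (Suc n))\<^sup>2 / (real (Suc k) * (real (n + k + 1))\<^sup>2)) \<le> 1"
proof (cases "Suc n \<le> m")
  case True
  have "(\<Sum>k\<in>{Suc n..<m}. (real (Suc n))\<^sup>2 / (real (Suc k) * (real (n + k + 1))\<^sup>2))
      \<le> (\<Sum>k\<in>{Suc n..<m}. real (Suc n) * (1 / real (n + k) - 1 / real (n + Suc k)))"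
  proof (rule sum_mono)
    fix k assume k: "k \<in> {Suc n..<m}"
    have "(real (Suc n))\<^sup>2 / (real (Suc k) * (real (n + k + 1))\<^sup>2)
        = real (Suc n) * (real (Suc n) / real (Suc k)) * (1 / (real (n + k + 1))\<^sup>2)"
      by (simp add: power2_eq_square)
    also have "\<dots> \<le> real (Suc n) * 1 * (1 / (real (n + k) * real (n + k + 1)))"
      using k unfolding power2_eq_square
      by (intro mult_mono divide_left_mono mult_right_mono) (auto simp: divide_le_eq_1)
    also have "1 / (real (n + k) * real (n + k + 1)) = 1 / real (n + k) - 1 / real (n + Suc k)"
      using k by (simp add: field_simps)
    finally show "(real (Suc n))\<^sup>2 / (real (Suc k) * (real (n + k + 1))\<^sup>2)
        \<le> real (Suc n) * (1 / real (n + k) - 1 / real (n + Suc k))" by simp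
  qed
  also have "\<dots> = real (Suc n) * (1 / real (n + Suc n) - 1 / real (n + m))"
    unfolding sum_distrib_left[symmetric]
    using sum_Suc_diff'[OF True, of "\<lambda>k. - 1 / real (n + k)"] by simp
  also have "\<dots> \<le> real (Suc n) * (1 / real (n + Suc n))"
    by (intro mult_left_mono) auto
  also have "\<dots> \<le> 1" by (simp add: field_simps)
  finally show ?thesis .
qed simp

text \<open>Split at \<open>k = n\<close>. Up to there the kernel is at most 1; beyond,
  Cauchy-Schwarz with weight \<open>k+1\<close> and the preceding tail bound give
  \<open>sqrt A\<close>.\<close>

lemma sum_hilbert_kernel_le:
  fixes c :: "nat \<Rightarrow> real"
  assumes c: "\<And>n. 0 \<le> c n" and A: "\<And>m. (\<Sum>k<m. real (Suc k) * (c k)\<^sup>2) \<le> A"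
  shows "(\<Sum>k<m. c k * (real (Suc n) / real (n + k + 1))) \<le> (\<Sum>k\<le>n. c k) + sqrt A"
proof -
  have Ann: "0 \<le> A" using A[of 0] by simp
  \<comment> \<open>All \<open>k <= n\<close> are included even when \<open>m <= n\<close>, which is
    harmless as the terms are nonnegative.\<close>
  have "(\<Sum>k<m. c k * (real (Suc n) / real (n + k + 1)))
     \<le> (\<Sum>k\<in>{..n} \<union> {Suc n..<m}. c k * (real (Suc n) / real (n + k + 1)))"
    using c by (intro sum_mono2) auto
  also have "\<dots> = (\<Sum>k\<le>n. c k * (real (Suc n) / real (n + k + 1)))
     + (\<Sum>k\<in>{Suc n..<m}. c k * (real (Suc n) / real (n + k + 1)))"
    by (rule sum.union_disjoint) auto
  also have "(\<Sum>k\<le>n. c k * (real (Suc n) / real (n + k + 1))) \<le> (\<Sum>k\<le>n. c k)"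
    using c by (intro sum_mono mult_left_le) auto
  also have "(\<Sum>k\<in>{Suc n..<m}. c k * (real (Suc n) / real (n + k + 1))) \<le> sqrt A"
  proof (rule real_le_rsqrt)
    let ?x = "\<lambda>k. sqrt (real (Suc k))"
    have "(\<Sum>k\<in>{Suc n..<m}. c k * (real (Suc n) / real (n + k + 1)))\<^sup>2
      = (\<Sum>k\<in>{Suc n..<m}. (?x k * c k) * (real (Suc n) / (?x k * real (n + k + 1))))\<^sup>2"
      by (intro arg_cong[where f="\<lambda>y. y\<^sup>2"] sum.cong) auto
    also have "\<dots> \<le> (\<Sum>k\<in>{Suc n..<m}. (?x k * c k)\<^sup>2)
        * (\<Sum>k\<in>{Suc n..<m}. (real (Suc n) / (?x k * real (n + k + 1)))\<^sup>2)"
      by (rule Cauchy_Schwarz_ineq_sum)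
    also have "(\<Sum>k\<in>{Suc n..<m}. (?x k * c k)\<^sup>2) = (\<Sum>k\<in>{Suc n..<m}. real (Suc k) * (c k)\<^sup>2)"
      by (simp add: power_mult_distrib)
    also have "(\<Sum>k\<in>{Suc n..<m}. (real (Suc n) / (?x k * real (n + k + 1)))\<^sup>2)
        = (\<Sum>k\<in>{Suc n..<m}. (real (Suc n))\<^sup>2 / (real (Suc k) * (real (n + k + 1))\<^sup>2))"
      by (simp add: power_mult_distrib power_divide)
    also have "(\<Sum>k\<in>{Suc n..<m}. real (Suc k) * (c k)\<^sup>2) * \<dots> \<le> A * 1"
    proof (rule mult_mono[OF _ sum_inverse_cube_tail_le Ann])
      have "(\<Sum>k\<in>{Suc n..<m}. real (Suc k) * (c k)\<^sup>2) \<le> (\<Sum>k<m. real (Suc k) * (c k)\<^sup>2)"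
        by (rule sum_mono2) auto
      with A[of m] show "(\<Sum>k\<in>{Suc n..<m}. real (Suc k) * (c k)\<^sup>2) \<le> A" by simp
    qed (auto intro!: sum_nonneg)
    finally show "(\<Sum>k\<in>{Suc n..<m}. c k * (real (Suc n) / real (n + k + 1)))\<^sup>2 \<le> A" by simp
  qed
  finally show ?thesis by simp
qed

lemma harm_le_one_plus_ln: "n > 0 \<Longrightarrow> harm n \<le> 1 + ln (real n)"
  using decseqD[OF decseq_harm_diff_ln, of 0 "n - 1"] by (simp add: harm_expand)

subsection \<open>Boundedness and the tail condition\<close>

text \<open>Neighbouring weights \<open>n powr s\<close> and \<open>(n+1) powr s\<close> become
  interchangeable whatever the sign of \<open>s\<close>. This absorbs the index shift between the
  coefficients of \<open>g\<close> and those of its image.\<close>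

lemma powr_le_two_powr_abs_mult:
  fixes x y s :: real
  assumes "0 < x" "0 < y" "x \<le> 2 * y" "y \<le> 2 * x"
  shows "x powr s \<le> 2 powr \<bar>s\<bar> * y powr s"
proof (cases "s \<ge> 0")
  case True
  then have "x powr s \<le> (2 * y) powr s" using assms by (intro powr_mono2) auto
  with True assms show ?thesis by (simp add: powr_mult)
next
  case False
  then have "x powr s \<le> (y / 2) powr s" using assms by (intro powr_mono2') auto
  with False assms show ?thesis by (simp add: powr_divide powr_minus field_simps)
qed

lemma dirichlet_norm_nonneg:
  assumes "h \<in> dirichlet_space \<gamma>"
  shows "0 \<le> dirichlet_norm \<gamma> h"
  using assms unfolding dirichlet_norm_def dirichlet_space_def
  by (intro real_sqrt_ge_zero add_nonneg_nonneg suminf_nonneg) auto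

lemma dirichlet_norm_power2:
  assumes "h \<in> dirichlet_space \<gamma>"
  shows "(dirichlet_norm \<gamma> h)\<^sup>2 = (cmod (taylor_coeff h 0))\<^sup>2 +
           (\<Sum>n. real (Suc n) powr (1 - \<gamma>) * (cmod (taylor_coeff h (Suc n)))\<^sup>2)"
  using assms unfolding dirichlet_norm_def dirichlet_space_def
  by (intro real_sqrt_pow2 add_nonneg_nonneg suminf_nonneg) auto

text \<open>The weights \<open>k+1\<close> treat index 0 uniformly; replacing \<open>k\<close> by
  \<open>k+1\<close> for \<open>k >= 1\<close> costs the factor 2.\<close>

lemma sum_taylor_coeff_le_dirichlet_norm:
  assumes f: "f \<in> dirichlet_space 0"
  shows "(\<Sum>k<m. real (Suc k) * (cmod (taylor_coeff f k))\<^sup>2) \<le> 2 * (dirichlet_norm 0 f)\<^sup>2"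
proof -
  let ?a = "\<lambda>k. (cmod (taylor_coeff f k))\<^sup>2"
  have sm: "summable (\<lambda>k. real (Suc k) * ?a (Suc k))"
    using f by (simp add: dirichlet_space_def)
  have "(\<Sum>k<m. real (Suc k) * ?a k) \<le> (\<Sum>k<Suc m. real (Suc k) * ?a k)"
    by (rule sum_mono2) auto
  also have "\<dots> = ?a 0 + (\<Sum>k<m. real (Suc (Suc k)) * ?a (Suc k))"
    by (subst sum.lessThan_Suc_shift) simp
  also have "(\<Sum>k<m. real (Suc (Suc k)) * ?a (Suc k)) \<le> (\<Sum>k<m. 2 * (real (Suc k) * ?a (Suc k)))"
    unfolding mult.assoc[symmetric] by (intro sum_mono mult_right_mono) auto
  also have "\<dots> \<le> 2 * (\<Sum>k. real (Suc k) * ?a (Suc k))"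
    unfolding sum_distrib_left[symmetric]
    by (intro mult_left_mono sum_le_suminf sm) auto
  also have "?a 0 + 2 * (\<Sum>k. real (Suc k) * ?a (Suc k)) \<le> 2 * (dirichlet_norm 0 f)\<^sup>2"
    unfolding dirichlet_norm_power2[OF f] by simp
  finally show ?thesis by simp
qed

lemma summable_taylor_coeff_over_Suc:
  assumes f: "f \<in> dirichlet_space 0"
  shows "summable (\<lambda>k. cmod (taylor_coeff f k) / real (Suc k))"
proof (rule summable_comparison_test'[of _ 0])
  have 1: "summable (\<lambda>k. real (Suc k) * (cmod (taylor_coeff f k))\<^sup>2)"
    by (rule bounded_imp_summable[where B = "2 * (dirichlet_norm 0 f)\<^sup>2"])
       (use sum_taylor_coeff_le_dirichlet_norm[OF f, of "Suc _"] in \<open>auto simp: lessThan_Suc_atMost\<close>)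
  have 2: "summable (\<lambda>k. (1 / real (Suc k))\<^sup>2)"
    using inverse_power_summable[of 2, where 'a = real] summable_Suc_iff[of "\<lambda>k. inverse (real k ^ 2)"]
    by (simp add: power_divide inverse_eq_divide)
  show "summable (\<lambda>k. real (Suc k) * (cmod (taylor_coeff f k))\<^sup>2 + (1 / real (Suc k))\<^sup>2)"
    using 1 2 by (rule summable_add)
  fix k
  let ?x = "cmod (taylor_coeff f k)" and ?y = "1 / real (Suc k)"
  \<comment> \<open>The elementary bound of a product by the sum of squares splits each term into
    two summable ones.\<close>
  have "0 \<le> (?x - ?y)\<^sup>2" "0 \<le> ?x * ?y" by auto
  then have "?x * ?y \<le> ?x\<^sup>2 + ?y\<^sup>2" unfolding power2_diff by linarith
  also have "?x\<^sup>2 \<le> real (Suc k) * ?x\<^sup>2"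
    using mult_right_mono[of 1 "real (Suc k)" "?x\<^sup>2"] by simp
  finally show "norm (?x / real (Suc k)) \<le> real (Suc k) * ?x\<^sup>2 + ?y\<^sup>2" by simp
qed

text \<open>From here on only the series of the moments matters, so the integral is hidden behind an
  existential.\<close>

lemma hilbert_op_dirichlet:
  assumes g: "g holomorphic_on ball 0 1" and f: "f \<in> dirichlet_space 0"
  shows "hilbert_op g f holomorphic_on ball 0 1"
    and "\<exists>\<mu>. (\<forall>n. (\<lambda>k. taylor_coeff f k / of_nat (n + k + 1)) sums \<mu> n) \<and>
      (\<forall>n. taylor_coeff (hilbert_op g f) n = of_nat (Suc n) * taylor_coeff g (Suc n) * \<mu> n)"
proof -
  have "f holomorphic_on ball 0 1" using f by (simp add: dirichlet_space_def)
  note m = moments_power_series_01[OF this summable_taylor_coeff_over_Suc[OF f]]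
  show "hilbert_op g f holomorphic_on ball 0 1"
    by (rule hilbert_op_taylor(1)[OF g m(1)])
  show "\<exists>\<mu>. (\<forall>n. (\<lambda>k. taylor_coeff f k / of_nat (n + k + 1)) sums \<mu> n) \<and>
      (\<forall>n. taylor_coeff (hilbert_op g f) n = of_nat (Suc n) * taylor_coeff g (Suc n) * \<mu> n)"
    using m(2) hilbert_op_taylor(2)[OF g m(1)]
    by (intro exI[of _ "\<lambda>n. LBINT t:{0..<1}. f (complex_of_real t) * complex_of_real t ^ n"]) auto
qed

section \<open>Test functions\<close>

text \<open>Taylor polynomials of \<open>-log(1-z)/z\<close>, which just fails to lie in the
  Dirichlet space: its squared norm diverges logarithmically.\<close>

definition truncated_log :: "nat \<Rightarrow> complex \<Rightarrow> complex" where
  "truncated_log N z = (\<Sum>k<N. z ^ k / of_nat (Suc k))"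

lemma taylor_coeff_truncated_log:
  "taylor_coeff (truncated_log N) = (\<lambda>k. if k < N then 1 / of_nat (Suc k) else 0)"
proof (rule taylor_coeff_eqI)
  fix z :: complex
  have "(\<lambda>k. if k \<in> {..<N} then z ^ k / of_nat (Suc k) else 0) sums truncated_log N z"
    unfolding truncated_log_def by (intro sums_If_finite_set) auto
  then show "(\<lambda>k. (if k < N then 1 / of_nat (Suc k) else 0) * z ^ k) sums truncated_log N z"
    by (rule sums_cong[THEN iffD1, rotated]) auto
qed

lemma truncated_log_dirichlet:
  assumes "0 < N"
  shows "truncated_log N \<in> dirichlet_space 0" "(dirichlet_norm 0 (truncated_log N))\<^sup>2 \<le> harm N"
proof -
  obtain m where N: "N = Suc m" using assms by (cases N) auto
  let ?F = "\<lambda>n. real (Suc n) powr (1 - 0) * (cmod (taylor_coeff (truncated_log N) (Suc n)))\<^sup>2"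
  have z: "?F n = 0" if "n \<notin> {..<m}" for n
    using that by (simp add: taylor_coeff_truncated_log N)
  show mem: "truncated_log N \<in> dirichlet_space 0"
    unfolding dirichlet_space_def
  proof (intro CollectI conjI)
    show "truncated_log N holomorphic_on ball 0 1"
      unfolding truncated_log_def[abs_def] by (intro holomorphic_intros) auto
    show "summable ?F"
      by (rule summable_finite[of "{..<m}"]) (use z in auto)
  qed
  have "?F n \<le> inverse (real (Suc (Suc n)))" for n
  proof -
    have "?F n \<le> real (Suc n) * (1 / real (Suc (Suc n)))\<^sup>2"
      by (auto simp: taylor_coeff_truncated_log norm_divide simp del: of_nat_Suc)
    also have "\<dots> \<le> real (Suc (Suc n)) * (1 / real (Suc (Suc n)))\<^sup>2"
      by (intro mult_right_mono) auto
    finally show ?thesis by (simp add: power2_eq_square inverse_eq_divide)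
  qed
  then have "(\<Sum>n<m. ?F n) \<le> (\<Sum>n<m. inverse (real (Suc (Suc n))))"
    by (rule sum_mono)
  \<comment> \<open>The missing 1 is the contribution of the constant coefficient to the squared
    norm.\<close>
  then have "(\<Sum>n. ?F n) \<le> harm N - 1"
    unfolding N harm_altdef by (subst suminf_finite[of "{..<m}"], simp)
      (use z in \<open>auto simp: N sum.lessThan_Suc_shift simp del: sum.lessThan_Suc\<close>)
  then show "(dirichlet_norm 0 (truncated_log N))\<^sup>2 \<le> harm N"
    unfolding dirichlet_norm_power2[OF mem]
    by (simp add: taylor_coeff_truncated_log N)
qed

text \<open>The coefficients of the test function are nonnegative, so nothing cancels in the moment.
  For \<open>k < N <= n+1\<close> the kernel \<open>(n+1)/(n+k+1)\<close> is at least 1/2.\<close>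

lemma cmod_taylor_coeff_hilbert_op_truncated_log:
  assumes g: "g holomorphic_on ball 0 1" and N: "0 < N" "N \<le> Suc n"
  shows "harm N / 2 * cmod (taylor_coeff g (Suc n))
    \<le> cmod (taylor_coeff (hilbert_op g (truncated_log N)) n)"
proof -
  obtain \<mu> where \<mu>: "(\<lambda>k. taylor_coeff (truncated_log N) k / of_nat (n + k + 1)) sums \<mu> n"
    and c: "taylor_coeff (hilbert_op g (truncated_log N)) n = of_nat (Suc n) * taylor_coeff g (Suc n) * \<mu> n"
    using hilbert_op_dirichlet(2)[OF g truncated_log_dirichlet(1)[OF N(1)]] by blast
  define r where "r = (\<Sum>k<N. 1 / real (Suc k) / real (n + k + 1))"
  have "(\<lambda>k. if k \<in> {..<N} then 1 / of_nat (Suc k) / of_nat (n + k + 1) else 0 :: complex)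
      sums (\<Sum>k<N. 1 / of_nat (Suc k) / of_nat (n + k + 1))"
    by (intro sums_If_finite_set) auto
  also have "(\<lambda>k. if k \<in> {..<N} then 1 / of_nat (Suc k) / of_nat (n + k + 1) else 0 :: complex)
     = (\<lambda>k. taylor_coeff (truncated_log N) k / of_nat (n + k + 1))"
    by (auto simp: taylor_coeff_truncated_log fun_eq_iff)
  also have "(\<Sum>k<N. 1 / of_nat (Suc k) / of_nat (n + k + 1)) = complex_of_real r"
    by (simp add: r_def)
  finally have "\<mu> n = complex_of_real r"
    using \<mu> by (rule sums_unique2[rotated])
  then have "cmod (\<mu> n) = r"
    by (simp add: r_def sum_nonneg del: of_real_sum)
  moreover have "harm N / 2 \<le> real (Suc n) * r"
  proof -
    have "1 / 2 * inverse (real (Suc k)) \<le> real (Suc n) * (1 / real (Suc k) / real (n + k + 1))"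
      if "k < N" for k
    proof -
      have "1 / 2 \<le> real (Suc n) / real (n + k + 1)"
        using that N by (simp add: field_simps)
      from mult_right_mono[OF this, of "1 / real (Suc k)"] show ?thesis
        by (simp add: field_simps)
    qed
    then show ?thesis
      unfolding r_def harm_altdef sum_distrib_left sum_divide_distrib by (intro sum_mono) auto
  qed
  ultimately show ?thesis
    unfolding c norm_mult norm_of_nat
    using mult_right_mono[of "harm N / 2" "real (Suc n) * cmod (\<mu> n)" "cmod (taylor_coeff g (Suc n))"]
    by (simp add: mult_ac)
qed

section \<open>Necessity of the tail condition\<close>

text \<open>The test function has squared norm at most \<open>harm N\<close>, while its image gains
  \<open>(harm N)^2\<close> on the tail; the quotient is \<open>1 / harm N\<close>, at most
  \<open>1 / ln N\<close>.\<close>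

lemma hilbert_op_bounded_imp_tail:
  fixes g :: "complex \<Rightarrow> complex" and \<beta> :: real
  defines "v \<equiv> \<lambda>n. real n powr (1 - \<beta>) * (cmod (taylor_coeff g n))\<^sup>2"
  assumes g: "g holomorphic_on ball 0 1" and bdd: "bounded_dirichlet_op 0 \<beta> (hilbert_op g)"
  shows "summable v" "(\<lambda>N. \<Sum>n. v (n + N)) \<in> O(\<lambda>N. 1 / ln (real N))"
proof -
  obtain C where mem: "\<And>f. f \<in> dirichlet_space 0 \<Longrightarrow> hilbert_op g f \<in> dirichlet_space \<beta>"
    and C: "\<And>f. f \<in> dirichlet_space 0 \<Longrightarrow> dirichlet_norm \<beta> (hilbert_op g f) \<le> C * dirichlet_norm 0 f"
    using bdd unfolding bounded_dirichlet_op_def by blast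
  define K where "K = 2 powr \<bar>1 - \<beta>\<bar>"
  define T where "T N n = real (Suc n) powr (1 - \<beta>) *
    (cmod (taylor_coeff (hilbert_op g (truncated_log N)) (Suc n)))\<^sup>2" for N n
  have K: "K > 0" by (simp add: K_def)
  have v0: "v n \<ge> 0" for n by (simp add: v_def)
  have T0: "T N n \<ge> 0" for N n by (simp add: T_def)
  have Ts: "summable (T N)" if "0 < N" for N
    using mem[OF truncated_log_dirichlet(1)[OF that]] by (simp add: dirichlet_space_def T_def[abs_def])
  \<comment> \<open>Coefficient \<open>n+1\<close> of the image carries coefficient
    \<open>n+2\<close> of \<open>g\<close>. \<open>K\<close> pays for the shifted weight and 4 for
    the squared 1/2.\<close>
  have vT: "v (Suc (Suc n)) \<le> 4 * K / (harm N)\<^sup>2 * T N n" if N: "0 < N" "N \<le> Suc (Suc n)" for N n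
  proof -
    have h: "harm N > (0::real)" using N by simp
    have le: "(harm N / 2 * cmod (taylor_coeff g (Suc (Suc n))))\<^sup>2
        \<le> (cmod (taylor_coeff (hilbert_op g (truncated_log N)) (Suc n)))\<^sup>2"
      by (intro power_mono cmod_taylor_coeff_hilbert_op_truncated_log g N)
         (simp add: harm_nonneg)
    have "real (Suc (Suc n)) powr (1 - \<beta>) * (harm N / 2 * cmod (taylor_coeff g (Suc (Suc n))))\<^sup>2
        \<le> K * real (Suc n) powr (1 - \<beta>) * (cmod (taylor_coeff (hilbert_op g (truncated_log N)) (Suc n)))\<^sup>2"
      unfolding K_def by (rule mult_mono[OF powr_le_two_powr_abs_mult le]) auto
    then have "v (Suc (Suc n)) * ((harm N)\<^sup>2 / 4) \<le> K * T N n"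
      by (simp add: v_def T_def power_mult_distrib power_divide mult_ac)
    then have "v (Suc (Suc n)) * ((harm N)\<^sup>2 / 4) * (4 / (harm N)\<^sup>2) \<le> K * T N n * (4 / (harm N)\<^sup>2)"
      by (rule mult_right_mono) simp
    moreover have "v (Suc (Suc n)) * ((harm N)\<^sup>2 / 4) * (4 / (harm N)\<^sup>2) = v (Suc (Suc n))"
      using less_imp_neq[OF h, symmetric] by simp
    moreover have "K * T N n * (4 / (harm N)\<^sup>2) = 4 * K / (harm N)\<^sup>2 * T N n"
      by simp
    ultimately show ?thesis by linarith
  qed
  \<comment> \<open>The test function with \<open>N = 1\<close>, the constant 1, already gives
    summability.\<close>
  have "summable (\<lambda>n. v (Suc (Suc n)))"
  proof (rule summable_comparison_test'[of _ 0])
    show "summable (\<lambda>n. 4 * K / (harm 1)\<^sup>2 * T 1 n)"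
      by (intro summable_mult Ts) simp
    show "norm (v (Suc (Suc n))) \<le> 4 * K / (harm 1)\<^sup>2 * T 1 n" for n
      unfolding real_norm_def abs_of_nonneg[OF v0] by (rule vT) simp_all
  qed
  then show v: "summable v"
    using summable_iff_shift[of v 2] by simp
  show "(\<lambda>N. \<Sum>n. v (n + N)) \<in> O(\<lambda>N. 1 / ln (real N))"
  proof (rule bigoI[where c = "4 * K * C\<^sup>2"], rule eventually_sequentiallyI[of 2])
    fix N :: nat assume N: "2 \<le> N"
    obtain m where m: "N = Suc (Suc m)"
      using le_Suc_ex[OF N] by (auto simp: numeral_2_eq_2)
    have h: "harm N > (0::real)" using N by simp
    have ln: "0 < ln (real N)" using N by simp
    have lnh: "ln (real N) \<le> harm N"
      using euler_mascheroni_sequence_nonneg[of N] N by simp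
    note D = truncated_log_dirichlet[of N]
    have "(\<Sum>n. v (n + N)) \<le> (\<Sum>n. 4 * K / (harm N)\<^sup>2 * T N (n + m))"
    proof (intro suminf_le summable_mult summable_ignore_initial_segment Ts v)
      show "v (n + N) \<le> 4 * K / (harm N)\<^sup>2 * T N (n + m)" for n
        using vT[of N "n + m"] by (simp add: m)
    qed (use N in simp)
    also have "\<dots> = 4 * K / (harm N)\<^sup>2 * (\<Sum>n. T N (n + m))"
      using N by (intro suminf_mult summable_ignore_initial_segment Ts) auto
    also have "\<dots> \<le> 4 * K / (harm N)\<^sup>2 * (C\<^sup>2 * harm N)"
    proof (rule mult_left_mono)
      have "(\<Sum>n. T N (n + m)) \<le> (\<Sum>n. T N n)"
        using suminf_split_initial_segment[OF Ts, of N m] N T0 by (simp add: sum_nonneg)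
      also have "\<dots> \<le> (dirichlet_norm \<beta> (hilbert_op g (truncated_log N)))\<^sup>2"
        using dirichlet_norm_power2[OF mem[OF D(1)]] N by (simp add: T_def[abs_def])
      also have "\<dots> \<le> (C * dirichlet_norm 0 (truncated_log N))\<^sup>2"
        using N by (intro power_mono C D dirichlet_norm_nonneg mem) auto
      also have "\<dots> \<le> C\<^sup>2 * harm N"
        unfolding power_mult_distrib using N D(2) by (intro mult_left_mono) auto
      finally show "(\<Sum>n. T N (n + m)) \<le> C\<^sup>2 * harm N" .
    qed (use K in auto)
    also have "\<dots> = 4 * K * C\<^sup>2 / harm N"
      using h by (simp add: power2_eq_square)
    also have "\<dots> \<le> 4 * K * C\<^sup>2 / ln (real N)"
      using K h ln lnh by (intro divide_left_mono mult_nonneg_nonneg) auto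
    finally have "(\<Sum>n. v (n + N)) \<le> 4 * K * C\<^sup>2 / ln (real N)" .
    moreover have "0 \<le> (\<Sum>n. v (n + N))"
      by (intro suminf_nonneg summable_ignore_initial_segment v v0)
    ultimately show "norm (\<Sum>n. v (n + N)) \<le> 4 * K * C\<^sup>2 * norm (1 / ln (real N))"
      using ln by simp
  qed
qed

section \<open>Sufficiency of the tail condition\<close>

text \<open>The Hardy inequality needs a bound for every index, not only eventually. Below the
  threshold monotonicity suffices; above it \<open>harm N <= 1 + ln N\<close>.\<close>

lemma tail_mult_harm_bounded:
  fixes v :: "nat \<Rightarrow> real"
  assumes v0: "\<And>n. 0 \<le> v n" and sv: "summable v"
    and O: "(\<lambda>N. \<Sum>n. v (n + N)) \<in> O(\<lambda>N. 1 / ln (real N))"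
  shows "\<exists>B. \<forall>N. (\<Sum>n. v (n + N)) * harm N \<le> B"
proof -
  define V where "V N = (\<Sum>n. v (n + N))" for N
  have V0: "0 \<le> V N" for N
    unfolding V_def by (intro suminf_nonneg summable_ignore_initial_segment sv v0)
  have Vle: "V N \<le> V 0" for N
    using suminf_split_initial_segment[OF sv, of N] by (simp add: V_def v0 sum_nonneg)
  obtain c where "\<forall>\<^sub>F N in sequentially. norm (V N) \<le> c * norm (1 / ln (real N))"
    using O unfolding V_def by (elim landau_o.bigE)
  then obtain N0 where N0: "\<And>N. N \<ge> N0 \<Longrightarrow> norm (V N) \<le> c * norm (1 / ln (real N))"
    by (auto simp: eventually_sequentially)
  have "V N * harm N \<le> max (V 0 * harm (max N0 2)) (V 0 + c)" for N
  proof (cases "N \<le> max N0 2")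
    case True
    then have "V N * harm N \<le> V 0 * harm (max N0 2)"
      by (intro mult_mono Vle harm_mono V0 harm_nonneg)
    then show ?thesis by simp
  next
    case False
    then have N: "N \<ge> N0" "N \<ge> 2" by auto
    then have ln: "ln (real N) > 0" by simp
    have "V N * harm N \<le> V N * (1 + ln (real N))"
      using N by (intro mult_left_mono harm_le_one_plus_ln V0) auto
    also have "\<dots> = V N + V N * ln (real N)" by (simp add: algebra_simps)
    also have "V N * ln (real N) \<le> c"
      using N0[OF N(1)] ln V0[of N] by (simp add: field_simps)
    finally show ?thesis using Vle[of N] by simp
  qed
  then have "\<forall>N. V N * harm N \<le> max (V 0 * harm (max N0 2)) (V 0 + c)" by (rule allI)
  then show ?thesis unfolding V_def by (rule exI)
qed

text \<open>The kernel estimate is uniform in the number of terms and so passes to the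
  limit.\<close>

lemma cmod_moment_le:
  fixes a :: "nat \<Rightarrow> complex"
  assumes A: "\<And>m. (\<Sum>k<m. real (Suc k) * (cmod (a k))\<^sup>2) \<le> A"
    and \<mu>: "(\<lambda>k. a k / of_nat (n + k + 1)) sums \<mu>"
  shows "real (Suc n) * cmod \<mu> \<le> (\<Sum>k\<le>n. cmod (a k)) + sqrt A"
proof -
  have "(\<lambda>m. real (Suc n) * cmod (\<Sum>k<m. a k / of_nat (n + k + 1))) \<longlonglongrightarrow> real (Suc n) * cmod \<mu>"
    using \<mu> unfolding sums_def by (intro tendsto_intros)
  moreover have "real (Suc n) * cmod (\<Sum>k<m. a k / of_nat (n + k + 1)) \<le> (\<Sum>k\<le>n. cmod (a k)) + sqrt A" for m
  proof -
    have "real (Suc n) * cmod (\<Sum>k<m. a k / of_nat (n + k + 1))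
        \<le> real (Suc n) * (\<Sum>k<m. cmod (a k / of_nat (n + k + 1)))"
      by (intro mult_left_mono norm_sum) auto
    also have "\<dots> = (\<Sum>k<m. cmod (a k) * (real (Suc n) / real (n + k + 1)))"
      unfolding sum_distrib_left norm_divide norm_of_nat by (simp add: mult_ac)
    also have "\<dots> \<le> (\<Sum>k\<le>n. cmod (a k)) + sqrt A"
      by (rule sum_hilbert_kernel_le[OF _ A]) auto
    finally show ?thesis .
  qed
  ultimately show ?thesis using LIMSEQ_le_const2 by blast
qed

lemma tail_imp_hilbert_op_bounded:
  fixes g :: "complex \<Rightarrow> complex" and \<beta> :: real
  defines "v \<equiv> \<lambda>n. real n powr (1 - \<beta>) * (cmod (taylor_coeff g n))\<^sup>2"
  assumes g: "g holomorphic_on ball 0 1" and sv: "summable v"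
    and O: "(\<lambda>N. \<Sum>n. v (n + N)) \<in> O(\<lambda>N. 1 / ln (real N))"
  shows "bounded_dirichlet_op 0 \<beta> (hilbert_op g)"
proof -
  have v0: "v n \<ge> 0" for n by (simp add: v_def)
  obtain B where B: "\<And>N. (\<Sum>n. v (n + N)) * harm N \<le> B"
    using tail_mult_harm_bounded[OF v0 sv O] by blast
  define u where "u n = v (Suc n)" for n
  define K where "K = 2 powr \<bar>1 - \<beta>\<bar>"
  define U where "U = (\<Sum>n. u n)"
  \<comment> \<open>This is \<open>K * (8 * B + 2 * U)\<close> times the 2 contained in
    \<open>A\<close> below.\<close>
  define D where "D = K * (16 * B + 4 * U)"
  have K: "K \<ge> 1" by (simp add: K_def ge_one_powr_ge_zero)
  have u0: "u n \<ge> 0" for n by (simp add: u_def v0)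
  have su: "summable u" using sv unfolding u_def[abs_def] by (subst summable_Suc_iff)
  have U0: "U \<ge> 0" unfolding U_def by (intro suminf_nonneg su u0)
  have uB: "(\<Sum>i. u (i + n)) * harm (Suc n) \<le> B" for n
    using B[of "Suc n"] by (simp add: u_def)
  have main: "hilbert_op g f \<in> dirichlet_space \<beta> \<and>
      (dirichlet_norm \<beta> (hilbert_op g f))\<^sup>2 \<le> D * (dirichlet_norm 0 f)\<^sup>2"
    if f: "f \<in> dirichlet_space 0" for f
  proof -
    let ?h = "hilbert_op g f"
    define A where "A = 2 * (dirichlet_norm 0 f)\<^sup>2"
    define T where "T n = real (Suc n) powr (1 - \<beta>) * (cmod (taylor_coeff ?h (Suc n)))\<^sup>2" for n
    \<comment> \<open>With weight \<open>n+1\<close> at index \<open>n\<close>, \<open>W n\<close>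
      equals \<open>u n\<close> times the square of \<open>(n+1) |\<mu> n|\<close> exactly; the true
      weight is restored afterwards at the cost of \<open>K\<close>.\<close>
    define W where "W n = real (Suc n) powr (1 - \<beta>) * (cmod (taylor_coeff ?h n))\<^sup>2" for n
    obtain \<mu> where \<mu>: "\<And>n. (\<lambda>k. taylor_coeff f k / of_nat (n + k + 1)) sums \<mu> n"
      and h: "\<And>n. taylor_coeff ?h n = of_nat (Suc n) * taylor_coeff g (Suc n) * \<mu> n"
      using hilbert_op_dirichlet(2)[OF g f] by blast
    have A: "(\<Sum>k<m. real (Suc k) * (cmod (taylor_coeff f k))\<^sup>2) \<le> A" for m
      unfolding A_def by (rule sum_taylor_coeff_le_dirichlet_norm[OF f])
    have A0: "A \<ge> 0" by (simp add: A_def)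
    have B0: "B \<ge> 0" using B[of 0] by (simp add: harm_def)
    let ?S = "\<lambda>n. \<Sum>k\<le>n. cmod (taylor_coeff f k)"
    have W: "W n \<le> 2 * (u n * (?S n)\<^sup>2) + 2 * A * u n" for n
    proof -
      have "(real (Suc n) * cmod (\<mu> n))\<^sup>2 \<le> (?S n + sqrt A)\<^sup>2"
        by (intro power_mono cmod_moment_le A \<mu>) auto
      also have "\<dots> \<le> 2 * (?S n)\<^sup>2 + 2 * A"
        using zero_le_power2[of "?S n - sqrt A"] A0 by (simp add: power2_sum power2_diff)
      finally have "u n * (real (Suc n) * cmod (\<mu> n))\<^sup>2 \<le> u n * (2 * (?S n)\<^sup>2 + 2 * A)"
        by (intro mult_left_mono u0)
      moreover have "W n = u n * (real (Suc n) * cmod (\<mu> n))\<^sup>2"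
        unfolding W_def u_def v_def h norm_mult norm_of_nat by (simp add: power_mult_distrib mult_ac)
      ultimately show ?thesis by (simp add: algebra_simps)
    qed
    have WN: "(\<Sum>n<N. W n) \<le> (8 * B + 2 * U) * A" for N
    proof -
      have "(\<Sum>n<N. W n) \<le> (\<Sum>n<N. 2 * (u n * (?S n)\<^sup>2) + 2 * A * u n)"
        by (intro sum_mono W)
      also have "\<dots> = 2 * (\<Sum>n<N. u n * (?S n)\<^sup>2) + 2 * A * (\<Sum>n<N. u n)"
        by (simp only: sum.distrib sum_distrib_left)
      also have "\<dots> \<le> 2 * (4 * B * A) + 2 * A * U"
      proof (intro add_mono mult_left_mono)
        have "(\<Sum>n<N. u n * (?S n)\<^sup>2) \<le> 4 * B * (\<Sum>k<N. real (Suc k) * (cmod (taylor_coeff f k))\<^sup>2)"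
          by (intro hardy_harm_weight u0 su uB)
        also have "\<dots> \<le> 4 * B * A" using B0 by (intro mult_left_mono A) auto
        finally show "(\<Sum>n<N. u n * (?S n)\<^sup>2) \<le> 4 * B * A" .
        show "(\<Sum>n<N. u n) \<le> U" unfolding U_def by (intro sum_le_suminf su) (auto simp: u0)
      qed (use A0 in auto)
      finally show ?thesis by (simp add: algebra_simps)
    qed
    have T: "T n \<le> K * W (Suc n)" for n
      unfolding T_def W_def K_def mult.assoc[symmetric]
      by (intro mult_right_mono powr_le_two_powr_abs_mult) auto
    have T0: "T n \<ge> 0" for n by (simp add: T_def)
    have W0: "W n \<ge> 0" for n by (simp add: W_def)
    \<comment> \<open>\<open>W 0\<close> is the squared constant coefficient of the image;
      \<open>K >= 1\<close> lets it be absorbed.\<close>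
    have TN: "W 0 + (\<Sum>n<N. T n) \<le> K * ((8 * B + 2 * U) * A)" for N
    proof -
      have "W 0 + (\<Sum>n<N. T n) \<le> K * W 0 + (\<Sum>n<N. K * W (Suc n))"
        using K W0[of 0] mult_right_mono[of 1 K "W 0"] by (intro add_mono sum_mono T) auto
      also have "\<dots> = K * (\<Sum>n<Suc N. W n)"
        by (subst sum.lessThan_Suc_shift) (simp add: sum_distrib_left algebra_simps)
      also have "\<dots> \<le> K * ((8 * B + 2 * U) * A)"
        using K by (intro mult_left_mono WN) auto
      finally show ?thesis .
    qed
    have sT: "summable T"
    proof (rule bounded_imp_summable[OF T0])
      show "sum T {..n} \<le> K * ((8 * B + 2 * U) * A)" for n
        using TN[of "Suc n"] W0[of 0] unfolding lessThan_Suc_atMost by linarith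
    qed
    have mem: "?h \<in> dirichlet_space \<beta>"
      using sT hilbert_op_dirichlet(1)[OF g f] by (simp add: dirichlet_space_def T_def[abs_def])
    have "(\<Sum>n. T n) \<le> K * ((8 * B + 2 * U) * A) - W 0"
      using TN by (intro suminf_le_const sT) (simp add: algebra_simps)
    moreover have "(dirichlet_norm \<beta> ?h)\<^sup>2 = W 0 + (\<Sum>n. T n)"
      using dirichlet_norm_power2[OF mem] by (simp add: W_def T_def[abs_def])
    ultimately show ?thesis
      using mem by (simp add: D_def A_def algebra_simps)
  qed
  have "dirichlet_norm \<beta> (hilbert_op g f) \<le> sqrt D * dirichlet_norm 0 f"
    if f: "f \<in> dirichlet_space 0" for f
    using real_le_rsqrt[OF conjunct2[OF main[OF f]]] dirichlet_norm_nonneg[OF f]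
    by (simp add: real_sqrt_mult)
  then show ?thesis
    using main unfolding bounded_dirichlet_op_def by blast
qed

text \<open>Summability is a separate conjunct because \<open>suminf\<close> of a divergent series
  is an unspecified value. The term at index 0 vanishes, as \<open>0 powr s = 0\<close>.\<close>

theorem theorem2p14:
  fixes g :: "complex \<Rightarrow> complex" and b :: "nat \<Rightarrow> complex" and \<beta> :: real
  assumes "g holomorphic_on ball 0 1"
    and "\<And>z. z \<in> ball 0 1 \<Longrightarrow> (\<lambda>n. b n * z ^ n) sums g z"
  shows "bounded_dirichlet_op 0 \<beta> (hilbert_op g) \<longleftrightarrow>
    summable (\<lambda>n. real n powr (1 - \<beta>) * (cmod (b n))\<^sup>2) \<and>
    (\<lambda>N. \<Sum>n. real (n + N) powr (1 - \<beta>) * (cmod (b (n + N)))\<^sup>2)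
      \<in> O(\<lambda>N. 1 / ln (real N))"
proof -
  have b: "taylor_coeff g = b" by (rule taylor_coeff_eqI[OF assms(2)])
  show ?thesis
    using hilbert_op_bounded_imp_tail[OF assms(1), of \<beta>] tail_imp_hilbert_op_bounded[OF assms(1), of \<beta>]
    unfolding b by blast
qed

end
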